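(* Let $X$ and $\Omega$ be non-empty sets and let $\mathbf{k}$ be a commutative ring. (a) $\mathcal{F}(X,\Omega)$ is the free $\Omega$-operated semigroup on $X$. (b) $\mathbf{k}\,\mathcal{F}(X,\Omega)$ is the free $\Omega$-operated nonunitary $\mathbf{k}$-algebra on $X$. In both cases the structure map from $X$ sends $x\in X$ to the one-vertex tree $\bullet_x$ decorated by $x$.
   Context: **Operated semigroups and algebras.** An $\Omega$-operated semigroup is a semigroup $U$ together with maps of sets $\alpha_\omega:U\to U$, $\omega\in\Omega$. An $\Omega$-operated nonunitary $\mathbf{k}$-algebra is an associative, not necessarily unitary, $\mathbf{k}$-algebra with $\mathbf{k}$-linear maps $\alpha_\omega$, $\omega\in\Omega$. In neither case is compatibility of the operators with the product required. Morphisms are semigroup (resp. nonunitary $\mathbf{k}$-algebra) homomorphisms commuting with the operators indexed by each $\omega$. The free such object on a set $X$ is an object $U_X$ with a map of sets $j_X:X\to U_X$ such that for every object $V$ and map of sets $f:X\to V$ there is a unique morphism $\bar f:U_X\to V$ with $f=\bar f\circ j_X$. For a semigroup $Y$, $\mathbf{k}\,Y$ is the free $\mathbf{k}$-module on $Y$ with the natural nonunitary algebra structure; operators on $Y$ are extended $\mathbf{k}$-linearly. **Decorated forests.** A planar rooted tree is a (finite) rooted tree with a fixed embedding into the plane (so the children of each vertex are linearly ordered). A planar rooted forest is a noncommutative concatenation $T_1\cdots T_b$, $b\ge1$, of planar rooted trees. $\mathcal{F}(X,\Omega)$ is the set of planar rooted forests whose leaf vertices are decorated by elements of $X$ and whose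 non-leaf vertices are decorated by elements of $\Omega$; the only vertex of the one-vertex tree counts as a leaf. It is a semigroup under concatenation. For $\omega\in\Omega$ and $F=T_1\cdots T_b\in\mathcal{F}(X,\Omega)$, the grafting $\lfloor_\omega F\rfloor_\omega$ is the tree obtained by adding a new root decorated by $\omega$ together with an edge from it to the root of each of $T_1,\dots,T_b$ (in this order). The operators on $\mathcal{F}(X,\Omega)$ are $\lfloor_\omega\ \rfloor_\omega$, $\omega\in\Omega$. *)

theory Defs
  imports "HOL-Algebra.Module" "HOL-Library.FuncSet"
begin

section \<open>Operated semigroups and operated nonunitary algebras\<close>

text \<open>
  The structures below reuse the records of HOL-Algebra. None of them has a unit: the field
  \<open>one\<close> of the records carries no meaning and is never mentioned in the axioms or
  in the notion of morphism.
\<close>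

locale nonunital_semigroup =
  fixes G (structure)
  assumes m_closed: "\<lbrakk>x \<in> carrier G; y \<in> carrier G\<rbrakk> \<Longrightarrow> x \<otimes> y \<in> carrier G"
    and m_assoc: "\<lbrakk>x \<in> carrier G; y \<in> carrier G; z \<in> carrier G\<rbrakk>
      \<Longrightarrow> (x \<otimes> y) \<otimes> z = x \<otimes> (y \<otimes> z)"

locale operated_semigroup = nonunital_semigroup U
  for \<Omega> :: "'o set" and U (structure) and \<alpha> :: "'o \<Rightarrow> 'a \<Rightarrow> 'a" +
  assumes op_closed: "\<lbrakk>\<omega> \<in> \<Omega>; x \<in> carrier U\<rbrakk> \<Longrightarrow> \<alpha> \<omega> x \<in> carrier U"

definition op_semigroup_hom ::
  "'o set \<Rightarrow> ('a, 'm) monoid_scheme \<Rightarrow> ('o \<Rightarrow> 'a \<Rightarrow> 'a)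
    \<Rightarrow> ('b, 'n) monoid_scheme \<Rightarrow> ('o \<Rightarrow> 'b \<Rightarrow> 'b) \<Rightarrow> ('a \<Rightarrow> 'b) set" where
  "op_semigroup_hom \<Omega> U \<alpha> V \<beta> =
    {h \<in> hom U V. \<forall>\<omega>\<in>\<Omega>. \<forall>x\<in>carrier U. h (\<alpha> \<omega> x) = \<beta> \<omega> (h x)}"

locale nonunitary_algebra = module R M + nonunital_semigroup M
  for R (structure) and M (structure) +
  assumes mult_l_distr: "\<lbrakk>x \<in> carrier M; y \<in> carrier M; z \<in> carrier M\<rbrakk>
      \<Longrightarrow> (x \<oplus>\<^bsub>M\<^esub> y) \<otimes>\<^bsub>M\<^esub> z = x \<otimes>\<^bsub>M\<^esub> z \<oplus>\<^bsub>M\<^esub> y \<otimes>\<^bsub>M\<^esub> z"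
    and mult_r_distr: "\<lbrakk>x \<in> carrier M; y \<in> carrier M; z \<in> carrier M\<rbrakk>
      \<Longrightarrow> z \<otimes>\<^bsub>M\<^esub> (x \<oplus>\<^bsub>M\<^esub> y) = z \<otimes>\<^bsub>M\<^esub> x \<oplus>\<^bsub>M\<^esub> z \<otimes>\<^bsub>M\<^esub> y"
    and smult_mult_l: "\<lbrakk>a \<in> carrier R; x \<in> carrier M; y \<in> carrier M\<rbrakk>
      \<Longrightarrow> (a \<odot>\<^bsub>M\<^esub> x) \<otimes>\<^bsub>M\<^esub> y = a \<odot>\<^bsub>M\<^esub> (x \<otimes>\<^bsub>M\<^esub> y)"
    and smult_mult_r: "\<lbrakk>a \<in> carrier R; x \<in> carrier M; y \<in> carrier M\<rbrakk>
      \<Longrightarrow> x \<otimes>\<^bsub>M\<^esub> (a \<odot>\<^bsub>M\<^esub> y) = a \<odot>\<^bsub>M\<^esub> (x \<otimes>\<^bsub>M\<^esub> y)"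

definition linear_maps ::
  "('k, 'l) ring_scheme \<Rightarrow> ('k, 'a, 'm) module_scheme \<Rightarrow> ('k, 'b, 'n) module_scheme
    \<Rightarrow> ('a \<Rightarrow> 'b) set" where
  "linear_maps R M N =
    {h \<in> carrier M \<rightarrow> carrier N.
      (\<forall>x\<in>carrier M. \<forall>y\<in>carrier M. h (x \<oplus>\<^bsub>M\<^esub> y) = h x \<oplus>\<^bsub>N\<^esub> h y) \<and>
      (\<forall>a\<in>carrier R. \<forall>x\<in>carrier M. h (a \<odot>\<^bsub>M\<^esub> x) = a \<odot>\<^bsub>N\<^esub> h x)}"

locale operated_algebra = nonunitary_algebra R U
  for \<Omega> :: "'o set" and R (structure) and U (structure) and \<alpha> :: "'o \<Rightarrow> 'a \<Rightarrow> 'a" +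
  assumes op_linear: "\<omega> \<in> \<Omega> \<Longrightarrow> \<alpha> \<omega> \<in> linear_maps R U U"

definition op_algebra_hom ::
  "'o set \<Rightarrow> ('k, 'l) ring_scheme \<Rightarrow> ('k, 'a, 'm) module_scheme \<Rightarrow> ('o \<Rightarrow> 'a \<Rightarrow> 'a)
    \<Rightarrow> ('k, 'b, 'n) module_scheme \<Rightarrow> ('o \<Rightarrow> 'b \<Rightarrow> 'b) \<Rightarrow> ('a \<Rightarrow> 'b) set" where
  "op_algebra_hom \<Omega> R U \<alpha> V \<beta> = linear_maps R U V \<inter> op_semigroup_hom \<Omega> U \<alpha> V \<beta>"


section \<open>Free objects\<close>

text \<open>
  HOL cannot quantify over types inside a formula, so the type of the elements of the test
  objects \<open>V\<close> is passed as an argument; a theorem about \<open>TYPE('v)\<close> with \<open>'v\<close> a type variable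
  covers test objects with arbitrary carriers. Uniqueness of a morphism means uniqueness as
  a map on the carrier, hence the restriction to extensional functions.
\<close>

definition free_operated_semigroup ::
  "'v itself \<Rightarrow> 'x set \<Rightarrow> 'o set \<Rightarrow> ('a, 'm) monoid_scheme \<Rightarrow> ('o \<Rightarrow> 'a \<Rightarrow> 'a)
    \<Rightarrow> ('x \<Rightarrow> 'a) \<Rightarrow> bool" where
  "free_operated_semigroup _ X \<Omega> U \<alpha> j \<longleftrightarrow>
    operated_semigroup \<Omega> U \<alpha> \<and> j \<in> X \<rightarrow> carrier U \<and>
    (\<forall>(V :: 'v monoid) \<beta> f. operated_semigroup \<Omega> V \<beta> \<longrightarrow> f \<in> X \<rightarrow> carrier V \<longrightarrow>
      (\<exists>!h. h \<in> op_semigroup_hom \<Omega> U \<alpha> V \<beta> \<inter> extensional (carrier U) \<and>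
        (\<forall>x\<in>X. h (j x) = f x)))"

definition free_operated_algebra ::
  "'v itself \<Rightarrow> 'x set \<Rightarrow> 'o set \<Rightarrow> ('k, 'l) ring_scheme \<Rightarrow> ('k, 'a, 'm) module_scheme
    \<Rightarrow> ('o \<Rightarrow> 'a \<Rightarrow> 'a) \<Rightarrow> ('x \<Rightarrow> 'a) \<Rightarrow> bool" where
  "free_operated_algebra _ X \<Omega> R U \<alpha> j \<longleftrightarrow>
    operated_algebra \<Omega> R U \<alpha> \<and> j \<in> X \<rightarrow> carrier U \<and>
    (\<forall>(V :: ('k, 'v) module) \<beta> f. operated_algebra \<Omega> R V \<beta> \<longrightarrow> f \<in> X \<rightarrow> carrier V \<longrightarrow>
      (\<exists>!h. h \<in> op_algebra_hom \<Omega> R U \<alpha> V \<beta> \<inter> extensional (carrier U) \<and>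
        (\<forall>x\<in>X. h (j x) = f x)))"


section \<open>The algebra of a semigroup\<close>

text \<open>
  Elements of the free module on \<open>carrier Y\<close> are the finitely supported coefficient functions
  vanishing outside \<open>carrier Y\<close>; the product is the bilinear extension of the product of \<open>Y\<close>.
\<close>

definition semigroup_algebra ::
  "('k, 'l) ring_scheme \<Rightarrow> ('a, 'm) monoid_scheme \<Rightarrow> ('k, 'a \<Rightarrow> 'k) module" where
  "semigroup_algebra R Y =
    \<lparr>carrier = {a. range a \<subseteq> carrier R \<and> finite {y. a y \<noteq> \<zero>\<^bsub>R\<^esub>}
        \<and> {y. a y \<noteq> \<zero>\<^bsub>R\<^esub>} \<subseteq> carrier Y},
     mult = (\<lambda>a b w. finsum R (\<lambda>(u, v). a u \<otimes>\<^bsub>R\<^esub> b v)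
        {(u, v). a u \<noteq> \<zero>\<^bsub>R\<^esub> \<and> b v \<noteq> \<zero>\<^bsub>R\<^esub> \<and> u \<otimes>\<^bsub>Y\<^esub> v = w}),
     one = undefined,
     zero = (\<lambda>_. \<zero>\<^bsub>R\<^esub>),
     add = (\<lambda>a b w. a w \<oplus>\<^bsub>R\<^esub> b w),
     smult = (\<lambda>c a w. c \<otimes>\<^bsub>R\<^esub> a w)\<rparr>"

definition basis_elem :: "('k, 'l) ring_scheme \<Rightarrow> 'a \<Rightarrow> 'a \<Rightarrow> 'k" where
  "basis_elem R y = (\<lambda>w. if w = y then \<one>\<^bsub>R\<^esub> else \<zero>\<^bsub>R\<^esub>)"

definition linear_extension ::
  "('k, 'l) ring_scheme \<Rightarrow> ('o \<Rightarrow> 'a \<Rightarrow> 'a) \<Rightarrow> 'o \<Rightarrow> ('a \<Rightarrow> 'k) \<Rightarrow> ('a \<Rightarrow> 'k)" where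
  "linear_extension R \<alpha> \<omega> a = (\<lambda>w. finsum R a {u. a u \<noteq> \<zero>\<^bsub>R\<^esub> \<and> \<alpha> \<omega> u = w})"


section \<open>Decorated planar rooted forests\<close>

text \<open>A planar rooted tree with all vertices decorated: the root and the list of its branches.\<close>

datatype 'd ptree = Vertex 'd "'d ptree list"

fun leaf_decorations :: "'d ptree \<Rightarrow> 'd set" where
  "leaf_decorations (Vertex d ts) = (if ts = [] then {d} else \<Union>(leaf_decorations ` set ts))"

fun nonleaf_decorations :: "'d ptree \<Rightarrow> 'd set" where
  "nonleaf_decorations (Vertex d ts) =
    (if ts = [] then {} else insert d (\<Union>(nonleaf_decorations ` set ts)))"

text \<open>
  Decorations by \<open>X\<close> and \<open>\<Omega>\<close> live in a sum type, as the two sets may have different types.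
\<close>

definition forests :: "'x set \<Rightarrow> 'o set \<Rightarrow> ('x + 'o) ptree list set" where
  "forests X \<Omega> = {F. F \<noteq> [] \<and>
    (\<forall>T\<in>set F. leaf_decorations T \<subseteq> Inl ` X \<and> nonleaf_decorations T \<subseteq> Inr ` \<Omega>)}"

definition forest_semigroup :: "'x set \<Rightarrow> 'o set \<Rightarrow> ('x + 'o) ptree list monoid" where
  "forest_semigroup X \<Omega> = \<lparr>carrier = forests X \<Omega>, mult = (@), one = undefined\<rparr>"

definition graft :: "'o \<Rightarrow> ('x + 'o) ptree list \<Rightarrow> ('x + 'o) ptree list" where
  "graft \<omega> F = [Vertex (Inr \<omega>) F]"

definition bullet :: "'x \<Rightarrow> ('x + 'o) ptree list" where
  "bullet x = [Vertex (Inl x) []]"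

end

theory Submission
  imports Defs
begin

text \<open>
  Part (a). Every decorated forest is obtained from the one-vertex trees by graftings and
  concatenations (\<open>forests_induct\<close>), so a morphism out of the forests is determined by its values
  on the one-vertex trees. It exists because a forest has only one such construction up to
  associativity of the concatenation: a forest is a nonempty list of trees, and a tree that is not
  a single vertex is the grafting of a forest that can be read off from it. Evaluating a forest in
  an operated semigroup by recursion (\<open>eval_tree\<close>, with the nonempty products \<open>nonempty_prod\<close>)
  is therefore a morphism.

  Part (b) follows from (a) by an argument in which forests do not occur. For every operated
  semigroup \<open>U\<close>, its semigroup algebra over \<open>R\<close> is an operated algebra, and morphisms from it to
  an operated algebra \<open>V\<close> correspond to operated semigroup morphisms from \<open>U\<close> to \<open>V\<close>, with
  addition and scalars of \<open>V\<close> forgotten: one direction restricts to the basis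
  (\<open>op_algebra_hom_basis\<close>), the other extends linearly (\<open>lin_ext_op_algebra_hom\<close>). So the semigroup
  algebra is free on \<open>X\<close> as soon as \<open>U\<close> is (\<open>free_operated_algebra_semigroup_algebra\<close>). The
  identities involved, namely associativity of the product and compatibility of the linear
  extension with products and operators, equate maps that are linear in each argument. They are
  therefore checked on basis elements (\<open>semigroup_algebra_induct\<close>), where they are identities of
  \<open>U\<close>; sums over supports are manipulated only to prove that the maps are linear.
\<close>

section \<open>Free operated semigroups of forests\<close>

lemma bullet_in_forests: "x \<in> X \<Longrightarrow> bullet x \<in> forests X \<Omega>"
  by (simp add: bullet_def forests_def)

lemma append_in_forests:
  "F \<in> forests X \<Omega> \<Longrightarrow> G \<in> forests X \<Omega> \<Longrightarrow> F @ G \<in> forests X \<Omega>"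
  by (auto simp: forests_def)

lemma graft_in_forests:
  "\<omega> \<in> \<Omega> \<Longrightarrow> F \<in> forests X \<Omega> \<Longrightarrow> graft \<omega> F \<in> forests X \<Omega>"
  by (auto simp: forests_def graft_def)

text \<open>
  The one-vertex trees generate all forests. A tree of height zero is a one-vertex tree, any other
  tree is the grafting of its forest of branches, and a forest is the concatenation of its trees;
  this is an induction over trees with an induction over nonempty lists inside.
\<close>

lemma forests_induct [consumes 1, case_names bullet graft append]:
  assumes "F \<in> forests X \<Omega>"
    and bullet: "\<And>x. x \<in> X \<Longrightarrow> P (bullet x)"
    and graft: "\<And>\<omega> F. \<omega> \<in> \<Omega> \<Longrightarrow> F \<in> forests X \<Omega> \<Longrightarrow> P F \<Longrightarrow> P (graft \<omega> F)"
    and append: "\<And>F G. F \<in> forests X \<Omega> \<Longrightarrow> G \<in> forests X \<Omega> \<Longrightarrow> P F \<Longrightarrow> P G \<Longrightarrow> P (F @ G)"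
  shows "P F"
proof -
  have conc: "P F"
    if "F \<noteq> []" and "F \<in> forests X \<Omega>" and "\<And>T. T \<in> set F \<Longrightarrow> [T] \<in> forests X \<Omega> \<Longrightarrow> P [T]" for F
    using that
  proof (induction F rule: list_nonempty_induct)
    case (single T)
    then show ?case by simp
  next
    case (cons T F)
    then have "[T] \<in> forests X \<Omega>" "F \<in> forests X \<Omega>"
      by (auto simp: forests_def)
    with cons append[of "[T]" F] show ?case by simp
  qed
  have tree: "[T] \<in> forests X \<Omega> \<Longrightarrow> P [T]" for T
  proof (induction T)
    case (Vertex d ts)
    show ?case
    proof (cases "ts = []")
      case True
      with Vertex.prems obtain x where "x \<in> X" "d = Inl x"
        by (auto simp: forests_def)
      with True bullet show ?thesis by (simp add: bullet_def)
    next
      case False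
      with Vertex.prems obtain \<omega> where \<omega>: "\<omega> \<in> \<Omega>" "d = Inr \<omega>"
        by (auto simp: forests_def)
      have ts: "ts \<in> forests X \<Omega>"
        using Vertex.prems False by (force simp: forests_def)
      with \<omega> graft[of \<omega> ts] conc[of ts] False Vertex.IH show ?thesis
        by (simp add: graft_def)
    qed
  qed
  from assms(1) have "F \<noteq> []" by (simp add: forests_def)
  with conc assms(1) tree show ?thesis by blast
qed

lemma operated_semigroup_forests: "operated_semigroup \<Omega> (forest_semigroup X \<Omega>) graft"
  by unfold_locales
    (simp_all add: forest_semigroup_def append_in_forests graft_in_forests)

text \<open>A semigroup has no empty product, so the recursion stops at one-element lists.\<close>

fun nonempty_prod :: "('a, 'm) monoid_scheme \<Rightarrow> 'a list \<Rightarrow> 'a" where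
  "nonempty_prod V [] = undefined"
| "nonempty_prod V [a] = a"
| "nonempty_prod V (a # b # as) = a \<otimes>\<^bsub>V\<^esub> nonempty_prod V (b # as)"

lemma (in nonunital_semigroup) nonempty_prod_closed:
  "as \<noteq> [] \<Longrightarrow> set as \<subseteq> carrier G \<Longrightarrow> nonempty_prod G as \<in> carrier G"
  by (induction as rule: induct_list012) (simp_all add: m_closed)

lemma (in nonunital_semigroup) nonempty_prod_append:
  assumes "as \<noteq> []" "bs \<noteq> []" "set as \<subseteq> carrier G" "set bs \<subseteq> carrier G"
  shows "nonempty_prod G (as @ bs) = nonempty_prod G as \<otimes> nonempty_prod G bs"
  using assms(1,3)
proof (induction as rule: list_nonempty_induct)
  case (single a)
  with assms(2) show ?case by (cases bs) simp_all
next
  case (cons a as)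
  then obtain b cs where "as = b # cs" by (cases as) auto
  with cons assms nonempty_prod_closed[of as] nonempty_prod_closed[of bs] show ?case
    by (simp add: m_assoc)
qed

text \<open>
  A vertex decorated by \<open>Inl x\<close> is a leaf in every tree of \<open>forests X \<Omega>\<close>, so its list of branches
  is ignored.
\<close>

fun eval_tree ::
  "('a, 'm) monoid_scheme \<Rightarrow> ('o \<Rightarrow> 'a \<Rightarrow> 'a) \<Rightarrow> ('x \<Rightarrow> 'a) \<Rightarrow> ('x + 'o) ptree \<Rightarrow> 'a" where
  "eval_tree V \<beta> f (Vertex d ts) =
    (case d of Inl x \<Rightarrow> f x | Inr \<omega> \<Rightarrow> \<beta> \<omega> (nonempty_prod V (map (eval_tree V \<beta> f) ts)))"

definition eval_forest ::
  "('a, 'm) monoid_scheme \<Rightarrow> ('o \<Rightarrow> 'a \<Rightarrow> 'a) \<Rightarrow> ('x \<Rightarrow> 'a) \<Rightarrow> ('x + 'o) ptree list \<Rightarrow> 'a" where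
  "eval_forest V \<beta> f F = nonempty_prod V (map (eval_tree V \<beta> f) F)"

lemma eval_forest_bullet: "eval_forest V \<beta> f (bullet x) = f x"
  by (simp add: eval_forest_def bullet_def)

lemma eval_forest_graft: "eval_forest V \<beta> f (graft \<omega> F) = \<beta> \<omega> (eval_forest V \<beta> f F)"
  by (simp add: eval_forest_def graft_def)

lemma (in operated_semigroup) eval_tree_closed:
  assumes f: "f \<in> X \<rightarrow> carrier U" and "F \<in> forests X \<Omega>"
  shows "eval_tree U \<alpha> f ` set F \<subseteq> carrier U"
  using assms(2)
proof (induction rule: forests_induct)
  case (bullet x)
  with f show ?case by (auto simp: bullet_def)
next
  case (graft \<omega> F)
  moreover from graft have "F \<noteq> []" by (simp add: forests_def)
  ultimately show ?case
    by (simp add: graft_def op_closed nonempty_prod_closed)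
next
  case (append F G)
  then show ?case by (simp add: image_Un)
qed

lemma (in operated_semigroup) eval_forest_closed:
  assumes "f \<in> X \<rightarrow> carrier U" and "F \<in> forests X \<Omega>"
  shows "eval_forest U \<alpha> f F \<in> carrier U"
  using eval_tree_closed[OF assms] assms(2)
  by (simp add: eval_forest_def forests_def nonempty_prod_closed)

lemma (in operated_semigroup) eval_forest_append:
  assumes "f \<in> X \<rightarrow> carrier U" and "F \<in> forests X \<Omega>" "G \<in> forests X \<Omega>"
  shows "eval_forest U \<alpha> f (F @ G) = eval_forest U \<alpha> f F \<otimes> eval_forest U \<alpha> f G"
  using eval_tree_closed[OF assms(1,2)] eval_tree_closed[OF assms(1,3)] assms(2,3)
  by (simp add: eval_forest_def forests_def nonempty_prod_append)

lemma op_semigroup_homD: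
  assumes "h \<in> op_semigroup_hom \<Omega> U \<alpha> V \<beta>"
  shows "x \<in> carrier U \<Longrightarrow> h x \<in> carrier V"
    and "x \<in> carrier U \<Longrightarrow> y \<in> carrier U \<Longrightarrow> h (x \<otimes>\<^bsub>U\<^esub> y) = h x \<otimes>\<^bsub>V\<^esub> h y"
    and "\<omega> \<in> \<Omega> \<Longrightarrow> x \<in> carrier U \<Longrightarrow> h (\<alpha> \<omega> x) = \<beta> \<omega> (h x)"
  using assms by (auto simp: op_semigroup_hom_def hom_def)

lemma (in operated_semigroup) eval_forest_hom:
  assumes "f \<in> X \<rightarrow> carrier U"
  shows "restrict (eval_forest U \<alpha> f) (forests X \<Omega>)
    \<in> op_semigroup_hom \<Omega> (forest_semigroup X \<Omega>) graft U \<alpha>"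
  using eval_forest_closed[OF assms] eval_forest_append[OF assms]
  by (simp add: op_semigroup_hom_def hom_def forest_semigroup_def append_in_forests
      graft_in_forests eval_forest_graft)

lemma forest_hom_unique:
  assumes h: "h \<in> op_semigroup_hom \<Omega> (forest_semigroup X \<Omega>) graft V \<beta>"
    and h': "h' \<in> op_semigroup_hom \<Omega> (forest_semigroup X \<Omega>) graft V \<beta>"
    and eq: "\<And>x. x \<in> X \<Longrightarrow> h (bullet x) = h' (bullet x)"
    and "F \<in> forests X \<Omega>"
  shows "h F = h' F"
  using assms(4)
proof (induction rule: forests_induct)
  case (bullet x)
  then show ?case by (rule eq)
next
  case (graft \<omega> F)
  then show ?case
    using op_semigroup_homD(3)[OF h] op_semigroup_homD(3)[OF h']
    by (simp add: forest_semigroup_def)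
next
  case (append F G)
  then show ?case
    using op_semigroup_homD(2)[OF h, of F G] op_semigroup_homD(2)[OF h', of F G]
    by (simp add: forest_semigroup_def)
qed

text \<open>
  Evaluation is a morphism: compatibility with grafting is the recursion equation of \<open>eval_tree\<close>,
  and compatibility with concatenation is associativity in the target.
\<close>

theorem free_operated_semigroup_forests:
  "free_operated_semigroup TYPE('v) X \<Omega> (forest_semigroup X \<Omega>) graft bullet"
  unfolding free_operated_semigroup_def
proof (intro conjI allI impI)
  show "operated_semigroup \<Omega> (forest_semigroup X \<Omega>) graft"
    by (rule operated_semigroup_forests)
  show "bullet \<in> X \<rightarrow> carrier (forest_semigroup X \<Omega>)"
    by (simp add: forest_semigroup_def bullet_in_forests)
  fix V :: "'v monoid" and \<beta> :: "'b \<Rightarrow> 'v \<Rightarrow> 'v" and f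
  assume V: "operated_semigroup \<Omega> V \<beta>" and f: "f \<in> X \<rightarrow> carrier V"
  have carr: "carrier (forest_semigroup X \<Omega>) = forests X \<Omega>"
    by (simp add: forest_semigroup_def)
  show "\<exists>!h. h \<in> op_semigroup_hom \<Omega> (forest_semigroup X \<Omega>) graft V \<beta>
      \<inter> extensional (carrier (forest_semigroup X \<Omega>)) \<and> (\<forall>x\<in>X. h (bullet x) = f x)"
    unfolding carr
  proof (rule ex1I[where a = "restrict (eval_forest V \<beta> f) (forests X \<Omega>)"])
    show "restrict (eval_forest V \<beta> f) (forests X \<Omega>)
        \<in> op_semigroup_hom \<Omega> (forest_semigroup X \<Omega>) graft V \<beta> \<inter> extensional (forests X \<Omega>)
        \<and> (\<forall>x\<in>X. restrict (eval_forest V \<beta> f) (forests X \<Omega>) (bullet x) = f x)"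
      using operated_semigroup.eval_forest_hom[OF V f]
      by (simp add: bullet_in_forests eval_forest_bullet)
  next
    fix h
    assume h: "h \<in> op_semigroup_hom \<Omega> (forest_semigroup X \<Omega>) graft V \<beta>
        \<inter> extensional (forests X \<Omega>) \<and> (\<forall>x\<in>X. h (bullet x) = f x)"
    show "h = restrict (eval_forest V \<beta> f) (forests X \<Omega>)"
    proof (rule extensionalityI)
      show "h \<in> extensional (forests X \<Omega>)" using h by simp
      show "restrict (eval_forest V \<beta> f) (forests X \<Omega>) \<in> extensional (forests X \<Omega>)" by simp
      fix F assume F: "F \<in> forests X \<Omega>"
      show "h F = restrict (eval_forest V \<beta> f) (forests X \<Omega>) F"
      proof (rule forest_hom_unique[OF _ _ _ F])
        show "h \<in> op_semigroup_hom \<Omega> (forest_semigroup X \<Omega>) graft V \<beta>" using h by blast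
        show "restrict (eval_forest V \<beta> f) (forests X \<Omega>)
            \<in> op_semigroup_hom \<Omega> (forest_semigroup X \<Omega>) graft V \<beta>"
          by (rule operated_semigroup.eval_forest_hom[OF V f])
      qed (use h in \<open>simp add: bullet_in_forests eval_forest_bullet\<close>)
    qed
  qed
qed


section \<open>The semigroup algebra as a module with a bilinear product\<close>

lemma (in abelian_monoid) finsum_superset:
  assumes "finite B" "A \<subseteq> B" "f \<in> B \<rightarrow> carrier G" "\<And>x. x \<in> B - A \<Longrightarrow> f x = \<zero>"
  shows "finsum G f A = finsum G f B"
  using assms by (intro add.finprod_mono_neutral_cong_left) auto

lemma (in nonunitary_algebra) mult_zero:
  assumes "x \<in> carrier M"
  shows "\<zero>\<^bsub>M\<^esub> \<otimes>\<^bsub>M\<^esub> x = \<zero>\<^bsub>M\<^esub>" and "x \<otimes>\<^bsub>M\<^esub> \<zero>\<^bsub>M\<^esub> = \<zero>\<^bsub>M\<^esub>"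
  using assms smult_mult_l[of \<zero> "\<zero>\<^bsub>M\<^esub>" x] smult_mult_r[of \<zero> x "\<zero>\<^bsub>M\<^esub>"]
  by (simp_all add: m_closed)

lemma linear_maps_closed:
  "h \<in> linear_maps R M N \<Longrightarrow> x \<in> carrier M \<Longrightarrow> h x \<in> carrier N"
  by (auto simp: linear_maps_def)

lemma linear_maps_zero:
  assumes "module R M" "module R N" and h: "h \<in> linear_maps R M N"
  shows "h \<zero>\<^bsub>M\<^esub> = \<zero>\<^bsub>N\<^esub>"
proof -
  interpret M: module R M by fact
  interpret N: module R N by fact
  have "h \<zero>\<^bsub>M\<^esub> \<in> carrier N"
    using h M.M.zero_closed by (auto simp: linear_maps_def)
  moreover have "h (\<zero>\<^bsub>R\<^esub> \<odot>\<^bsub>M\<^esub> \<zero>\<^bsub>M\<^esub>) = \<zero>\<^bsub>R\<^esub> \<odot>\<^bsub>N\<^esub> h \<zero>\<^bsub>M\<^esub>"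
    using h M.M.zero_closed M.R.zero_closed unfolding linear_maps_def by blast
  ultimately show ?thesis by simp
qed

lemma linear_maps_compose:
  assumes "h \<in> linear_maps R L M" "h' \<in> linear_maps R M N"
  shows "(\<lambda>a. h' (h a)) \<in> linear_maps R L N"
  using assms by (auto simp: linear_maps_def Pi_iff)

locale semigroup_algebra_base = R?: cring R + Y: nonunital_semigroup Y
  for R :: "('k, 'l) ring_scheme" (structure) and Y :: "('a, 'm) monoid_scheme" +
  fixes A
  defines "A \<equiv> semigroup_algebra R Y"
begin

definition supp :: "('a \<Rightarrow> 'k) \<Rightarrow> 'a set" where
  "supp a = {y. a y \<noteq> \<zero>}"

lemma carrier_iff:
  "a \<in> carrier A \<longleftrightarrow> (\<forall>y. a y \<in> carrier R) \<and> finite (supp a) \<and> supp a \<subseteq> carrier Y"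
  by (auto simp: A_def semigroup_algebra_def supp_def)

lemma supp_closed: "a \<in> carrier A \<Longrightarrow> supp a \<subseteq> carrier Y"
  by (simp add: carrier_iff)

lemma not_in_supp: "y \<notin> supp a \<Longrightarrow> a y = \<zero>"
  by (simp add: supp_def)

lemma carrierI:
  assumes "\<And>y. a y \<in> carrier R" "finite S" "S \<subseteq> carrier Y" "\<And>y. y \<notin> S \<Longrightarrow> a y = \<zero>"
  shows "a \<in> carrier A"
proof -
  from assms(4) have "supp a \<subseteq> S" by (auto simp: supp_def)
  with assms show ?thesis by (auto simp: carrier_iff intro: finite_subset)
qed

lemma coeff_closed [simp]: "a \<in> carrier A \<Longrightarrow> a y \<in> carrier R"
  using carrier_iff by blast

lemma finite_supp [simp]: "a \<in> carrier A \<Longrightarrow> finite (supp a)"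
  using carrier_iff by blast

lemma zero_A [simp]: "\<zero>\<^bsub>A\<^esub> = (\<lambda>_. \<zero>)"
  and add_A [simp]: "a \<oplus>\<^bsub>A\<^esub> b = (\<lambda>y. a y \<oplus> b y)"
  and smult_A [simp]: "c \<odot>\<^bsub>A\<^esub> a = (\<lambda>y. c \<otimes> a y)"
  by (simp_all add: A_def semigroup_algebra_def)

lemma zero_closed_A: "(\<lambda>_. \<zero>) \<in> carrier A"
  by (rule carrierI[of _ "{}"]) auto

lemma add_closed_A:
  assumes "a \<in> carrier A" "b \<in> carrier A"
  shows "(\<lambda>y. a y \<oplus> b y) \<in> carrier A"
  using assms supp_closed
  by (intro carrierI[of _ "supp a \<union> supp b"]) (auto simp: not_in_supp)

lemma smult_closed_A:
  assumes "c \<in> carrier R" "a \<in> carrier A"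
  shows "(\<lambda>y. c \<otimes> a y) \<in> carrier A"
  using assms supp_closed
  by (intro carrierI[of _ "supp a"]) (auto simp: not_in_supp)

lemma module_A: "module R A"
proof (rule moduleI)
  show "abelian_group A"
  proof (rule abelian_groupI)
    fix a assume a: "a \<in> carrier A"
    then have "(\<lambda>y. \<ominus> a y) \<in> carrier A"
      using supp_closed
      by (intro carrierI[of _ "supp a"]) (auto simp: not_in_supp)
    then show "\<exists>b\<in>carrier A. b \<oplus>\<^bsub>A\<^esub> a = \<zero>\<^bsub>A\<^esub>"
      using a by (intro bexI[of _ "\<lambda>y. \<ominus> a y"]) (auto simp: R.l_neg)
  qed (auto simp: zero_closed_A add_closed_A R.a_ac)
qed (auto simp: smult_closed_A R.l_distr R.r_distr R.m_assoc R.cring_axioms)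

lemma mult_A: "(a \<otimes>\<^bsub>A\<^esub> b) w
  = finsum R (\<lambda>(u, v). a u \<otimes> b v) {(u, v). u \<in> supp a \<and> v \<in> supp b \<and> u \<otimes>\<^bsub>Y\<^esub> v = w}"
  by (simp add: A_def semigroup_algebra_def supp_def)

text \<open>
  The supports of two factors and of their sums differ. Summing over a common finite superset of
  the supports makes the product visibly bilinear.
\<close>

lemma mult_A_superset:
  assumes a: "a \<in> carrier A" "supp a \<subseteq> S" "finite S"
    and b: "b \<in> carrier A" "supp b \<subseteq> T" "finite T"
  shows "(a \<otimes>\<^bsub>A\<^esub> b) w = (\<Oplus>p \<in> {p \<in> S \<times> T. fst p \<otimes>\<^bsub>Y\<^esub> snd p = w}. a (fst p) \<otimes> b (snd p))"
  unfolding mult_A case_prod_unfold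
proof (rule R.finsum_superset)
  fix p
  assume "p \<in> {p \<in> S \<times> T. fst p \<otimes>\<^bsub>Y\<^esub> snd p = w}
    - {p. fst p \<in> supp a \<and> snd p \<in> supp b \<and> fst p \<otimes>\<^bsub>Y\<^esub> snd p = w}"
  then have "fst p \<notin> supp a \<or> snd p \<notin> supp b" by auto
  then show "a (fst p) \<otimes> b (snd p) = \<zero>"
    using a b by (auto simp: not_in_supp)
qed (use a b in auto)

lemma mult_closed_A:
  assumes a: "a \<in> carrier A" and b: "b \<in> carrier A"
  shows "a \<otimes>\<^bsub>A\<^esub> b \<in> carrier A"
proof (rule carrierI)
  let ?S = "(\<lambda>p. fst p \<otimes>\<^bsub>Y\<^esub> snd p) ` (supp a \<times> supp b)"
  show "finite ?S" using a b by simp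
  show "?S \<subseteq> carrier Y"
    using supp_closed[OF a] supp_closed[OF b] by (auto intro!: Y.m_closed)
  show "(a \<otimes>\<^bsub>A\<^esub> b) w \<in> carrier R" for w
    unfolding mult_A using a b by (intro R.finsum_closed) auto
  fix w assume "w \<notin> ?S"
  then have "{(u, v). u \<in> supp a \<and> v \<in> supp b \<and> u \<otimes>\<^bsub>Y\<^esub> v = w} = {}"
    by force
  then show "(a \<otimes>\<^bsub>A\<^esub> b) w = \<zero>"
    by (simp only: mult_A R.finsum_empty)
qed

lemma mult_l_distr_A:
  assumes "a \<in> carrier A" "b \<in> carrier A" "c \<in> carrier A"
  shows "(a \<oplus>\<^bsub>A\<^esub> b) \<otimes>\<^bsub>A\<^esub> c = a \<otimes>\<^bsub>A\<^esub> c \<oplus>\<^bsub>A\<^esub> b \<otimes>\<^bsub>A\<^esub> c"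
proof
  fix w
  let ?S = "supp a \<union> supp b"
  have "supp (a \<oplus>\<^bsub>A\<^esub> b) \<subseteq> ?S" by (auto simp: supp_def)
  with assms have "((a \<oplus>\<^bsub>A\<^esub> b) \<otimes>\<^bsub>A\<^esub> c) w
      = (\<Oplus>p \<in> {p \<in> ?S \<times> supp c. fst p \<otimes>\<^bsub>Y\<^esub> snd p = w}.
          a (fst p) \<otimes> c (snd p) \<oplus> b (fst p) \<otimes> c (snd p))"
    by (subst mult_A_superset[where S = ?S and T = "supp c"])
      (auto simp: add_closed_A R.l_distr intro!: R.finsum_cong')
  also have "\<dots> = (a \<otimes>\<^bsub>A\<^esub> c) w \<oplus> (b \<otimes>\<^bsub>A\<^esub> c) w"
    using assms
    by (simp add: mult_A_superset[where S = ?S and T = "supp c"] R.finsum_addf)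
  finally show "((a \<oplus>\<^bsub>A\<^esub> b) \<otimes>\<^bsub>A\<^esub> c) w = (a \<otimes>\<^bsub>A\<^esub> c \<oplus>\<^bsub>A\<^esub> b \<otimes>\<^bsub>A\<^esub> c) w"
    by simp
qed

lemma mult_r_distr_A:
  assumes "a \<in> carrier A" "b \<in> carrier A" "c \<in> carrier A"
  shows "c \<otimes>\<^bsub>A\<^esub> (a \<oplus>\<^bsub>A\<^esub> b) = c \<otimes>\<^bsub>A\<^esub> a \<oplus>\<^bsub>A\<^esub> c \<otimes>\<^bsub>A\<^esub> b"
proof
  fix w
  let ?S = "supp a \<union> supp b"
  have "supp (a \<oplus>\<^bsub>A\<^esub> b) \<subseteq> ?S" by (auto simp: supp_def)
  with assms have "(c \<otimes>\<^bsub>A\<^esub> (a \<oplus>\<^bsub>A\<^esub> b)) w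
      = (\<Oplus>p \<in> {p \<in> supp c \<times> ?S. fst p \<otimes>\<^bsub>Y\<^esub> snd p = w}.
          c (fst p) \<otimes> a (snd p) \<oplus> c (fst p) \<otimes> b (snd p))"
    by (subst mult_A_superset[where S = "supp c" and T = ?S])
      (auto simp: add_closed_A R.r_distr intro!: R.finsum_cong')
  also have "\<dots> = (c \<otimes>\<^bsub>A\<^esub> a) w \<oplus> (c \<otimes>\<^bsub>A\<^esub> b) w"
    using assms
    by (simp add: mult_A_superset[where S = "supp c" and T = ?S] R.finsum_addf)
  finally show "(c \<otimes>\<^bsub>A\<^esub> (a \<oplus>\<^bsub>A\<^esub> b)) w = (c \<otimes>\<^bsub>A\<^esub> a \<oplus>\<^bsub>A\<^esub> c \<otimes>\<^bsub>A\<^esub> b) w"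
    by simp
qed

lemma smult_mult_l_A:
  assumes "r \<in> carrier R" "a \<in> carrier A" "b \<in> carrier A"
  shows "(r \<odot>\<^bsub>A\<^esub> a) \<otimes>\<^bsub>A\<^esub> b = r \<odot>\<^bsub>A\<^esub> (a \<otimes>\<^bsub>A\<^esub> b)"
proof
  fix w
  have "supp (r \<odot>\<^bsub>A\<^esub> a) \<subseteq> supp a"
    using assms by (auto simp: supp_def)
  with assms have "((r \<odot>\<^bsub>A\<^esub> a) \<otimes>\<^bsub>A\<^esub> b) w
      = (\<Oplus>p \<in> {p \<in> supp a \<times> supp b. fst p \<otimes>\<^bsub>Y\<^esub> snd p = w}. r \<otimes> (a (fst p) \<otimes> b (snd p)))"
    by (subst mult_A_superset[where S = "supp a" and T = "supp b"])
      (auto simp: smult_closed_A R.m_assoc intro!: R.finsum_cong')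
  also have "\<dots> = r \<otimes> (a \<otimes>\<^bsub>A\<^esub> b) w"
    using assms
    by (simp add: mult_A_superset[where S = "supp a" and T = "supp b"] R.finsum_rdistr)
  finally show "((r \<odot>\<^bsub>A\<^esub> a) \<otimes>\<^bsub>A\<^esub> b) w = (r \<odot>\<^bsub>A\<^esub> (a \<otimes>\<^bsub>A\<^esub> b)) w"
    by simp
qed

lemma smult_mult_r_A:
  assumes "r \<in> carrier R" "a \<in> carrier A" "b \<in> carrier A"
  shows "a \<otimes>\<^bsub>A\<^esub> (r \<odot>\<^bsub>A\<^esub> b) = r \<odot>\<^bsub>A\<^esub> (a \<otimes>\<^bsub>A\<^esub> b)"
proof
  fix w
  have "supp (r \<odot>\<^bsub>A\<^esub> b) \<subseteq> supp b"
    using assms by (auto simp: supp_def)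
  with assms have "(a \<otimes>\<^bsub>A\<^esub> (r \<odot>\<^bsub>A\<^esub> b)) w
      = (\<Oplus>p \<in> {p \<in> supp a \<times> supp b. fst p \<otimes>\<^bsub>Y\<^esub> snd p = w}. r \<otimes> (a (fst p) \<otimes> b (snd p)))"
    by (subst mult_A_superset[where S = "supp a" and T = "supp b"])
      (auto simp: smult_closed_A R.m_lcomm intro!: R.finsum_cong')
  also have "\<dots> = r \<otimes> (a \<otimes>\<^bsub>A\<^esub> b) w"
    using assms
    by (simp add: mult_A_superset[where S = "supp a" and T = "supp b"] R.finsum_rdistr)
  finally show "(a \<otimes>\<^bsub>A\<^esub> (r \<odot>\<^bsub>A\<^esub> b)) w = (r \<odot>\<^bsub>A\<^esub> (a \<otimes>\<^bsub>A\<^esub> b)) w"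
    by simp
qed


section \<open>Checking multilinear identities on the basis\<close>

lemma basis_closed: "y \<in> carrier Y \<Longrightarrow> basis_elem R y \<in> carrier A"
  by (rule carrierI[of _ "{y}"]) (auto simp: basis_elem_def)

lemma supp_basis: "supp (basis_elem R y) \<subseteq> {y}"
  by (auto simp: supp_def basis_elem_def)

lemma basis_mult:
  assumes "u \<in> carrier Y" "v \<in> carrier Y"
  shows "basis_elem R u \<otimes>\<^bsub>A\<^esub> basis_elem R v = basis_elem R (u \<otimes>\<^bsub>Y\<^esub> v)"
proof
  fix w
  have "{p \<in> {u} \<times> {v}. fst p \<otimes>\<^bsub>Y\<^esub> snd p = w} = (if u \<otimes>\<^bsub>Y\<^esub> v = w then {(u, v)} else {})"
    by auto
  then show "(basis_elem R u \<otimes>\<^bsub>A\<^esub> basis_elem R v) w = basis_elem R (u \<otimes>\<^bsub>Y\<^esub> v) w"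
    using assms
    by (simp add: mult_A_superset[where S = "{u}" and T = "{v}"] basis_closed supp_basis)
      (simp add: basis_elem_def)
qed

text \<open>
  The basis spans: splitting off one point of the support at a time writes an element as a finite
  sum of multiples of basis elements.
\<close>

lemma semigroup_algebra_induct [consumes 1, case_names zero smult add]:
  assumes "a \<in> carrier A"
    and zero: "P \<zero>\<^bsub>A\<^esub>"
    and smult: "\<And>r y. r \<in> carrier R \<Longrightarrow> y \<in> carrier Y \<Longrightarrow> P (r \<odot>\<^bsub>A\<^esub> basis_elem R y)"
    and add: "\<And>a b. a \<in> carrier A \<Longrightarrow> b \<in> carrier A \<Longrightarrow> P a \<Longrightarrow> P b \<Longrightarrow> P (a \<oplus>\<^bsub>A\<^esub> b)"
  shows "P a"
proof -
  have "P a" if "finite S" "S \<subseteq> carrier Y" "a \<in> carrier A" "supp a \<subseteq> S" for S a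
    using that
  proof (induction S arbitrary: a rule: finite_induct)
    case empty
    then have "a = \<zero>\<^bsub>A\<^esub>" by (auto simp: supp_def)
    with zero show ?case by simp
  next
    case (insert y S)
    let ?b = "a(y := \<zero>)" and ?c = "a y \<odot>\<^bsub>A\<^esub> basis_elem R y"
    have y: "y \<in> carrier Y" and S: "S \<subseteq> carrier Y" using insert.prems by auto
    have supp_b: "supp ?b \<subseteq> S" using insert.prems by (auto simp: supp_def split: if_splits)
    have b: "?b \<in> carrier A"
      by (rule carrierI[of _ S]) (use insert S supp_b in \<open>auto simp: supp_def\<close>)
    have c: "?c \<in> carrier A"
      using insert.prems y by (simp add: smult_closed_A basis_closed)
    have eq: "a = ?b \<oplus>\<^bsub>A\<^esub> ?c"
      using insert.prems by (auto simp: basis_elem_def fun_eq_iff)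
    have "P ?b" by (rule insert.IH[OF S b supp_b])
    moreover have "P ?c" by (rule smult) (use insert.prems y in simp_all)
    ultimately have "P (?b \<oplus>\<^bsub>A\<^esub> ?c)" by (rule add[OF b c])
    then show ?case by (simp only: eq[symmetric])
  qed
  then show ?thesis
    using assms(1) by (meson finite_supp supp_closed subset_refl)
qed

lemma mult_zero_A:
  assumes "a \<in> carrier A"
  shows "\<zero>\<^bsub>A\<^esub> \<otimes>\<^bsub>A\<^esub> a = \<zero>\<^bsub>A\<^esub>" and "a \<otimes>\<^bsub>A\<^esub> \<zero>\<^bsub>A\<^esub> = \<zero>\<^bsub>A\<^esub>"
proof -
  interpret A: module R A by (rule module_A)
  show "\<zero>\<^bsub>A\<^esub> \<otimes>\<^bsub>A\<^esub> a = \<zero>\<^bsub>A\<^esub>" and "a \<otimes>\<^bsub>A\<^esub> \<zero>\<^bsub>A\<^esub> = \<zero>\<^bsub>A\<^esub>"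
    using assms smult_mult_l_A[of \<zero> "\<zero>\<^bsub>A\<^esub>" a] smult_mult_r_A[of \<zero> a "\<zero>\<^bsub>A\<^esub>"]
    by (simp_all add: mult_closed_A zero_closed_A)
qed

(* Unfolded into coefficient functions, sums and multiples would not match the linearity rules. *)
declare zero_A [simp del] add_A [simp del] smult_A [simp del]

text \<open>
  Associativity is trilinear, so the arguments are reduced to basis elements one at a time, from
  right to left; on three basis elements it is associativity of the semigroup.
\<close>

lemma mult_assoc_A:
  assumes "a \<in> carrier A" "b \<in> carrier A" "c \<in> carrier A"
  shows "(a \<otimes>\<^bsub>A\<^esub> b) \<otimes>\<^bsub>A\<^esub> c = a \<otimes>\<^bsub>A\<^esub> (b \<otimes>\<^bsub>A\<^esub> c)"
proof -
  have 1: "(basis_elem R u \<otimes>\<^bsub>A\<^esub> basis_elem R v) \<otimes>\<^bsub>A\<^esub> c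
      = basis_elem R u \<otimes>\<^bsub>A\<^esub> (basis_elem R v \<otimes>\<^bsub>A\<^esub> c)"
    if uv: "u \<in> carrier Y" "v \<in> carrier Y" and "c \<in> carrier A" for u v c
    using that(3)
  proof (induction rule: semigroup_algebra_induct)
    case zero
    then show ?case using uv by (simp add: mult_zero_A basis_closed mult_closed_A)
  next
    case (smult r y)
    then show ?case using uv
      by (simp add: smult_mult_r_A basis_closed mult_closed_A basis_mult Y.m_closed Y.m_assoc)
  next
    case (add a b)
    then show ?case using uv by (simp add: mult_r_distr_A basis_closed mult_closed_A)
  qed
  have 2: "(basis_elem R u \<otimes>\<^bsub>A\<^esub> b) \<otimes>\<^bsub>A\<^esub> c = basis_elem R u \<otimes>\<^bsub>A\<^esub> (b \<otimes>\<^bsub>A\<^esub> c)"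
    if u: "u \<in> carrier Y" and c: "c \<in> carrier A" and "b \<in> carrier A" for u b c
    using that(3)
  proof (induction rule: semigroup_algebra_induct)
    case zero
    then show ?case using u c by (simp add: mult_zero_A basis_closed)
  next
    case (smult r y)
    then show ?case using u c 1
      by (simp add: smult_mult_r_A smult_mult_l_A basis_closed mult_closed_A)
  next
    case (add a b)
    then show ?case using u c
      by (simp add: mult_r_distr_A mult_l_distr_A basis_closed mult_closed_A)
  qed
  show ?thesis using assms(1)
  proof (induction rule: semigroup_algebra_induct)
    case zero
    then show ?case using assms by (simp add: mult_zero_A mult_closed_A)
  next
    case (smult r y)
    then show ?case using assms 2
      by (simp add: smult_mult_l_A basis_closed mult_closed_A)
  next
    case (add a b)
    then show ?case using assms by (simp add: mult_l_distr_A mult_closed_A)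
  qed
qed

lemma nonunitary_algebra_A: "nonunitary_algebra R A"
proof -
  interpret A: module R A by (rule module_A)
  show ?thesis
    by unfold_locales (simp_all add: mult_closed_A mult_assoc_A mult_l_distr_A mult_r_distr_A
        smult_mult_l_A smult_mult_r_A)
qed

lemma linear_maps_eq_on_basis:
  assumes V: "module R V" and h: "h \<in> linear_maps R A V" and h': "h' \<in> linear_maps R A V"
    and basis: "\<And>y. y \<in> carrier Y \<Longrightarrow> h (basis_elem R y) = h' (basis_elem R y)"
    and "a \<in> carrier A"
  shows "h a = h' a"
  using assms(5)
proof (induction rule: semigroup_algebra_induct)
  case zero
  show ?case using linear_maps_zero[OF module_A V] h h' by metis
next
  case (smult r y)
  then show ?case using h h' basis by (simp add: linear_maps_def basis_closed)
next
  case (add a b)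
  then show ?case using h h' by (simp add: linear_maps_def)
qed


section \<open>The operated algebra of an operated semigroup\<close>

lemma linear_extension_superset:
  assumes "a \<in> carrier A" "supp a \<subseteq> S" "finite S"
  shows "linear_extension R \<alpha> \<omega> a w = finsum R a {u \<in> S. \<alpha> \<omega> u = w}"
  unfolding linear_extension_def
  using assms by (intro R.finsum_superset) (auto simp: supp_def)

lemma linear_extension_linear:
  assumes \<alpha>: "\<And>y. y \<in> carrier Y \<Longrightarrow> \<alpha> \<omega> y \<in> carrier Y"
  shows "linear_extension R \<alpha> \<omega> \<in> linear_maps R A A"
proof -
  have "linear_extension R \<alpha> \<omega> a \<in> carrier A" if a: "a \<in> carrier A" for a
  proof (rule carrierI)
    show "finite (\<alpha> \<omega> ` supp a)" using a by simp
    show "\<alpha> \<omega> ` supp a \<subseteq> carrier Y" using supp_closed[OF a] \<alpha> by auto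
    show "linear_extension R \<alpha> \<omega> a w \<in> carrier R" for w
      unfolding linear_extension_def using a by (intro R.finsum_closed) auto
    fix w assume "w \<notin> \<alpha> \<omega> ` supp a"
    then have "{u. a u \<noteq> \<zero> \<and> \<alpha> \<omega> u = w} = {}" by (auto simp: supp_def)
    then show "linear_extension R \<alpha> \<omega> a w = \<zero>"
      by (simp only: linear_extension_def R.finsum_empty)
  qed
  moreover have "linear_extension R \<alpha> \<omega> (a \<oplus>\<^bsub>A\<^esub> b)
      = linear_extension R \<alpha> \<omega> a \<oplus>\<^bsub>A\<^esub> linear_extension R \<alpha> \<omega> b"
    if ab: "a \<in> carrier A" "b \<in> carrier A" for a b
  proof
    fix w
    let ?S = "supp a \<union> supp b"
    have "supp (a \<oplus>\<^bsub>A\<^esub> b) \<subseteq> ?S" by (auto simp: supp_def add_A)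
    then show "linear_extension R \<alpha> \<omega> (a \<oplus>\<^bsub>A\<^esub> b) w
        = (linear_extension R \<alpha> \<omega> a \<oplus>\<^bsub>A\<^esub> linear_extension R \<alpha> \<omega> b) w"
      using ab by (simp add: linear_extension_superset[where S = ?S] add_A add_closed_A
          R.finsum_addf)
  qed
  moreover have "linear_extension R \<alpha> \<omega> (r \<odot>\<^bsub>A\<^esub> a) = r \<odot>\<^bsub>A\<^esub> linear_extension R \<alpha> \<omega> a"
    if ra: "r \<in> carrier R" "a \<in> carrier A" for r a
  proof
    fix w
    have "supp (r \<odot>\<^bsub>A\<^esub> a) \<subseteq> supp a" using ra by (auto simp: supp_def smult_A)
    then show "linear_extension R \<alpha> \<omega> (r \<odot>\<^bsub>A\<^esub> a) w = (r \<odot>\<^bsub>A\<^esub> linear_extension R \<alpha> \<omega> a) w"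
      using ra by (simp add: linear_extension_superset[where S = "supp a"] smult_A smult_closed_A
          R.finsum_rdistr)
  qed
  ultimately show ?thesis by (simp add: linear_maps_def)
qed

lemma linear_extension_basis:
  assumes "u \<in> carrier Y"
  shows "linear_extension R \<alpha> \<omega> (basis_elem R u) = basis_elem R (\<alpha> \<omega> u)"
proof
  fix w
  have "{x \<in> {u}. \<alpha> \<omega> x = w} = (if \<alpha> \<omega> u = w then {u} else {})" by auto
  then show "linear_extension R \<alpha> \<omega> (basis_elem R u) w = basis_elem R (\<alpha> \<omega> u) w"
    using assms
    by (simp add: linear_extension_superset[where S = "{u}"] basis_closed supp_basis)
      (simp add: basis_elem_def)
qed

lemma operated_algebra_A:
  assumes "operated_semigroup \<Omega> Y \<alpha>"
  shows "operated_algebra \<Omega> R A (linear_extension R \<alpha>)"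
proof -
  interpret A: nonunitary_algebra R A by (rule nonunitary_algebra_A)
  show ?thesis
    using operated_semigroup.op_closed[OF assms]
    by unfold_locales (simp add: linear_extension_linear)
qed

text \<open>
  The inclusion \<open>y \<mapsto> basis_elem R y\<close> respects products and operators, hence so does its composition
  with an algebra morphism.
\<close>

lemma op_algebra_hom_basis:
  assumes "operated_semigroup \<Omega> Y \<alpha>"
    and "h \<in> op_algebra_hom \<Omega> R A (linear_extension R \<alpha>) V \<beta>"
  shows "restrict (\<lambda>y. h (basis_elem R y)) (carrier Y) \<in> op_semigroup_hom \<Omega> Y \<alpha> V \<beta>"
proof -
  have h: "h \<in> op_semigroup_hom \<Omega> A (linear_extension R \<alpha>) V \<beta>"
    using assms(2) by (simp add: op_algebra_hom_def)
  show ?thesis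
    using op_semigroup_homD[OF h] operated_semigroup.op_closed[OF assms(1)]
    by (simp add: op_semigroup_hom_def hom_def Y.m_closed basis_closed basis_mult[symmetric]
        linear_extension_basis[where \<alpha> = \<alpha>, symmetric])
qed


section \<open>Extending morphisms from the basis\<close>

definition lin_ext :: "('k, 'v, 'n) module_scheme \<Rightarrow> ('a \<Rightarrow> 'v) \<Rightarrow> ('a \<Rightarrow> 'k) \<Rightarrow> 'v" where
  "lin_ext V g a = finsum V (\<lambda>y. a y \<odot>\<^bsub>V\<^esub> g y) (supp a)"

context
  fixes V :: "('k, 'v, 'n) module_scheme" and g :: "'a \<Rightarrow> 'v"
  assumes V: "module R V" and g: "g \<in> carrier Y \<rightarrow> carrier V"
begin

interpretation V: module R V by (rule V)

lemma lin_ext_superset: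
  assumes a: "a \<in> carrier A" and S: "supp a \<subseteq> S" "finite S" "S \<subseteq> carrier Y"
  shows "lin_ext V g a = finsum V (\<lambda>y. a y \<odot>\<^bsub>V\<^esub> g y) S"
  unfolding lin_ext_def
proof (rule V.M.finsum_superset)
  show "(\<lambda>y. a y \<odot>\<^bsub>V\<^esub> g y) \<in> S \<rightarrow> carrier V"
    using a S g by (auto intro!: V.smult_closed)
  fix y assume y: "y \<in> S - supp a"
  then have "g y \<in> carrier V" using S g by auto
  with y show "a y \<odot>\<^bsub>V\<^esub> g y = \<zero>\<^bsub>V\<^esub>" by (simp add: not_in_supp)
qed (use S in auto)

lemma lin_ext_basis:
  assumes "y \<in> carrier Y"
  shows "lin_ext V g (basis_elem R y) = g y"
proof -
  have "g y \<in> carrier V" using assms g by auto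
  then show ?thesis
    using assms
    by (simp add: lin_ext_superset[where S = "{y}"] basis_closed supp_basis)
      (simp add: basis_elem_def)
qed

lemma lin_ext_linear: "lin_ext V g \<in> linear_maps R A V"
proof -
  have gV: "g y \<in> carrier V" if "y \<in> carrier Y" for y using g that by auto
  have "lin_ext V g a \<in> carrier V" if "a \<in> carrier A" for a
    unfolding lin_ext_def using that supp_closed[OF that] gV by (intro V.M.finsum_closed) auto
  moreover have "lin_ext V g (a \<oplus>\<^bsub>A\<^esub> b) = lin_ext V g a \<oplus>\<^bsub>V\<^esub> lin_ext V g b"
    if ab: "a \<in> carrier A" "b \<in> carrier A" for a b
  proof -
    let ?S = "supp a \<union> supp b"
    have S: "?S \<subseteq> carrier Y" using supp_closed[OF ab(1)] supp_closed[OF ab(2)] by simp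
    have "supp (a \<oplus>\<^bsub>A\<^esub> b) \<subseteq> ?S" by (auto simp: supp_def add_A)
    then have "lin_ext V g (a \<oplus>\<^bsub>A\<^esub> b) = finsum V (\<lambda>y. (a \<oplus>\<^bsub>A\<^esub> b) y \<odot>\<^bsub>V\<^esub> g y) ?S"
      using ab S by (intro lin_ext_superset) (auto simp: add_A add_closed_A)
    also have "\<dots> = finsum V (\<lambda>y. a y \<odot>\<^bsub>V\<^esub> g y \<oplus>\<^bsub>V\<^esub> b y \<odot>\<^bsub>V\<^esub> g y) ?S"
      using ab S gV
      by (intro V.M.finsum_cong') (auto simp: add_A V.smult_l_distr subset_iff)
    also have "\<dots> = lin_ext V g a \<oplus>\<^bsub>V\<^esub> lin_ext V g b"
      using ab S gV
      by (subst V.M.finsum_addf)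
        (auto simp: lin_ext_superset[where S = ?S] subset_iff)
    finally show ?thesis .
  qed
  moreover have "lin_ext V g (r \<odot>\<^bsub>A\<^esub> a) = r \<odot>\<^bsub>V\<^esub> lin_ext V g a"
    if ra: "r \<in> carrier R" "a \<in> carrier A" for r a
  proof -
    have S: "supp a \<subseteq> carrier Y" using supp_closed[OF ra(2)] .
    have "supp (r \<odot>\<^bsub>A\<^esub> a) \<subseteq> supp a" using ra by (auto simp: supp_def smult_A)
    then have "lin_ext V g (r \<odot>\<^bsub>A\<^esub> a) = finsum V (\<lambda>y. (r \<odot>\<^bsub>A\<^esub> a) y \<odot>\<^bsub>V\<^esub> g y) (supp a)"
      using ra S by (intro lin_ext_superset) (auto simp: smult_A smult_closed_A)
    also have "\<dots> = finsum V (\<lambda>y. r \<odot>\<^bsub>V\<^esub> (a y \<odot>\<^bsub>V\<^esub> g y)) (supp a)"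
      using ra S gV
      by (intro V.M.finsum_cong') (auto simp: smult_A V.smult_assoc1 subset_iff)
    also have "\<dots> = r \<odot>\<^bsub>V\<^esub> lin_ext V g a"
      unfolding lin_ext_def using ra S gV
      by (intro V.finsum_smult_ldistr[symmetric]) auto
    finally show ?thesis .
  qed
  ultimately show ?thesis by (simp add: linear_maps_def)
qed

end

text \<open>
  Both sides are bilinear in \<open>a\<close> and \<open>b\<close>, so it suffices that \<open>g\<close> is multiplicative on the basis.
\<close>

lemma lin_ext_mult:
  assumes V: "nonunitary_algebra R V" and g: "g \<in> hom Y V"
    and a: "a \<in> carrier A" and b: "b \<in> carrier A"
  shows "lin_ext V g (a \<otimes>\<^bsub>A\<^esub> b) = lin_ext V g a \<otimes>\<^bsub>V\<^esub> lin_ext V g b"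
proof -
  interpret V: nonunitary_algebra R V by (rule V)
  interpret A: nonunitary_algebra R A by (rule nonunitary_algebra_A)
  have gV: "g \<in> carrier Y \<rightarrow> carrier V" using g by (simp add: hom_def)
  let ?h = "lin_ext V g"
  note lin = lin_ext_linear[OF V.module_axioms gV]
  have h_closed: "?h x \<in> carrier V" if "x \<in> carrier A" for x
    using lin that by (auto simp: linear_maps_def)
  have h_add: "?h (x \<oplus>\<^bsub>A\<^esub> y) = ?h x \<oplus>\<^bsub>V\<^esub> ?h y" if "x \<in> carrier A" "y \<in> carrier A" for x y
    using lin that by (simp add: linear_maps_def)
  have h_smult: "?h (r \<odot>\<^bsub>A\<^esub> x) = r \<odot>\<^bsub>V\<^esub> ?h x" if "r \<in> carrier R" "x \<in> carrier A" for r x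
    using lin that by (simp add: linear_maps_def)
  have h_zero: "?h \<zero>\<^bsub>A\<^esub> = \<zero>\<^bsub>V\<^esub>"
    by (rule linear_maps_zero[OF module_A V.module_axioms lin])
  have basis: "?h (basis_elem R u \<otimes>\<^bsub>A\<^esub> b) = ?h (basis_elem R u) \<otimes>\<^bsub>V\<^esub> ?h b"
    if u: "u \<in> carrier Y" and "b \<in> carrier A" for u b
    using that(2)
  proof (induction rule: semigroup_algebra_induct)
    case zero
    then show ?case using u by (simp add: h_zero A.mult_zero V.mult_zero basis_closed h_closed)
  next
    case (smult r y)
    then show ?case using u g
      by (simp add: h_smult smult_mult_r_A V.smult_mult_r basis_closed h_closed mult_closed_A)
        (simp add: basis_mult lin_ext_basis[OF V.module_axioms gV] Y.m_closed hom_def)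
  next
    case (add a b)
    then show ?case using u
      by (simp add: h_add mult_r_distr_A V.mult_r_distr basis_closed h_closed mult_closed_A)
  qed
  show ?thesis using a
  proof (induction rule: semigroup_algebra_induct)
    case zero
    then show ?case using b by (simp add: h_zero A.mult_zero V.mult_zero h_closed)
  next
    case (smult r y)
    then show ?case using b basis
      by (simp add: h_smult smult_mult_l_A V.smult_mult_l basis_closed h_closed mult_closed_A)
  next
    case (add a a')
    then show ?case using b
      by (simp add: h_add mult_l_distr_A V.mult_l_distr h_closed mult_closed_A)
  qed
qed

text \<open>
  Both \<open>h \<circ> \<alpha>\<close> and \<open>\<beta> \<circ> h\<close> are linear, because the operators of \<open>V\<close> are; so compatibility
  with the operators needs to hold on the basis only, where it is the hypothesis on \<open>g\<close>.
\<close>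

lemma lin_ext_op_algebra_hom:
  assumes Y\<alpha>: "operated_semigroup \<Omega> Y \<alpha>" and V: "operated_algebra \<Omega> R V \<beta>"
    and g: "g \<in> op_semigroup_hom \<Omega> Y \<alpha> V \<beta>"
  shows "restrict (lin_ext V g) (carrier A)
    \<in> op_algebra_hom \<Omega> R A (linear_extension R \<alpha>) V \<beta>"
proof -
  interpret V: operated_algebra \<Omega> R V \<beta> by (rule V)
  interpret A: operated_algebra \<Omega> R A "linear_extension R \<alpha>"
    by (rule operated_algebra_A[OF Y\<alpha>])
  have hom: "g \<in> hom Y V" using g by (simp add: op_semigroup_hom_def)
  then have gV: "g \<in> carrier Y \<rightarrow> carrier V" by (simp add: hom_def)
  note lin = lin_ext_linear[OF V.module_axioms gV]
  have op: "lin_ext V g (linear_extension R \<alpha> \<omega> a) = \<beta> \<omega> (lin_ext V g a)"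
    if \<omega>: "\<omega> \<in> \<Omega>" and a: "a \<in> carrier A" for \<omega> a
  proof (rule linear_maps_eq_on_basis[OF V.module_axioms _ _ _ a])
    show "(\<lambda>a. lin_ext V g (linear_extension R \<alpha> \<omega> a)) \<in> linear_maps R A V"
      by (rule linear_maps_compose[OF A.op_linear[OF \<omega>] lin])
    show "(\<lambda>a. \<beta> \<omega> (lin_ext V g a)) \<in> linear_maps R A V"
      by (rule linear_maps_compose[OF lin V.op_linear[OF \<omega>]])
    fix y assume "y \<in> carrier Y"
    then show "lin_ext V g (linear_extension R \<alpha> \<omega> (basis_elem R y))
        = \<beta> \<omega> (lin_ext V g (basis_elem R y))"
      using \<omega> operated_semigroup.op_closed[OF Y\<alpha>] op_semigroup_homD(3)[OF g]
      by (simp add: linear_extension_basis lin_ext_basis[OF V.module_axioms gV])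
  qed
  show ?thesis
    using lin op lin_ext_mult[OF V.nonunitary_algebra_axioms hom] linear_maps_closed[OF A.op_linear]
    by (auto simp: op_algebra_hom_def op_semigroup_hom_def hom_def linear_maps_def mult_closed_A
        A.M.a_closed A.smult_closed)
qed

end

text \<open>
  The universal property of a free operated semigroup speaks of bare \<open>monoid\<close> records. To apply it
  to an algebra, addition and scalar multiplication are cut off from the record, which leaves the
  morphisms into it unchanged.
\<close>

lemma operated_algebra_imp_operated_semigroup:
  assumes "operated_algebra \<Omega> R V \<beta>"
  shows "operated_semigroup \<Omega> (monoid.truncate V) \<beta>"
proof -
  interpret V: operated_algebra \<Omega> R V \<beta> by (rule assms)
  show ?thesis
    using linear_maps_closed[OF V.op_linear]
    by unfold_locales (simp_all add: monoid.truncate_def V.m_closed V.m_assoc)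
qed

lemma op_semigroup_hom_truncate:
  "op_semigroup_hom \<Omega> U \<alpha> (monoid.truncate V) \<beta> = op_semigroup_hom \<Omega> U \<alpha> V \<beta>"
  by (simp add: op_semigroup_hom_def hom_def monoid.truncate_def)

text \<open>
  Existence extends linearly the semigroup morphism given by freeness of \<open>U\<close>. For uniqueness, two
  algebra morphisms that agree on the generators restrict to semigroup morphisms on the basis, which
  are equal by freeness of \<open>U\<close>, and linear maps are determined by their values on the basis.
\<close>

theorem free_operated_algebra_semigroup_algebra:
  fixes R :: "('k, 'l) ring_scheme"
  assumes free: "free_operated_semigroup TYPE('v) X \<Omega> U \<alpha> j" and R: "cring R"
  shows "free_operated_algebra TYPE('v) X \<Omega> R (semigroup_algebra R U)
    (linear_extension R \<alpha>) (\<lambda>x. basis_elem R (j x))"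
proof -
  have U: "operated_semigroup \<Omega> U \<alpha>" and j: "j \<in> X \<rightarrow> carrier U"
    using free by (simp_all add: free_operated_semigroup_def)
  interpret B: semigroup_algebra_base R U "semigroup_algebra R U"
    using R U by (simp add: semigroup_algebra_base_def operated_semigroup_def)
  let ?A = "semigroup_algebra R U"
  show ?thesis
    unfolding free_operated_algebra_def
  proof (intro conjI allI impI)
    show "operated_algebra \<Omega> R ?A (linear_extension R \<alpha>)"
      by (rule B.operated_algebra_A[OF U])
    show "(\<lambda>x. basis_elem R (j x)) \<in> X \<rightarrow> carrier ?A"
      using j B.basis_closed by auto
    fix V :: "('k, 'v) module" and \<beta> f
    assume V: "operated_algebra \<Omega> R V \<beta>" and f: "f \<in> X \<rightarrow> carrier V"
    interpret V: operated_algebra \<Omega> R V \<beta> by (rule V)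
    have f': "f \<in> X \<rightarrow> carrier (monoid.truncate V)"
      using f by (simp add: monoid.truncate_def)
    have "\<exists>!g. g \<in> op_semigroup_hom \<Omega> U \<alpha> (monoid.truncate V) \<beta> \<inter> extensional (carrier U) \<and>
        (\<forall>x\<in>X. g (j x) = f x)"
      using free operated_algebra_imp_operated_semigroup[OF V] f'
      unfolding free_operated_semigroup_def by blast
    then have ex1: "\<exists>!g. g \<in> op_semigroup_hom \<Omega> U \<alpha> V \<beta> \<inter> extensional (carrier U) \<and>
        (\<forall>x\<in>X. g (j x) = f x)"
      by (simp only: op_semigroup_hom_truncate)
    then obtain g where g: "g \<in> op_semigroup_hom \<Omega> U \<alpha> V \<beta>" and gj: "\<forall>x\<in>X. g (j x) = f x"
      by blast
    have gV: "g \<in> carrier U \<rightarrow> carrier V"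
      using op_semigroup_homD(1)[OF g] by blast
    show "\<exists>!h. h \<in> op_algebra_hom \<Omega> R ?A (linear_extension R \<alpha>) V \<beta> \<inter> extensional (carrier ?A)
        \<and> (\<forall>x\<in>X. h (basis_elem R (j x)) = f x)"
    proof (rule ex_ex1I)
      show "\<exists>h. h \<in> op_algebra_hom \<Omega> R ?A (linear_extension R \<alpha>) V \<beta> \<inter> extensional (carrier ?A)
          \<and> (\<forall>x\<in>X. h (basis_elem R (j x)) = f x)"
        using B.lin_ext_op_algebra_hom[OF U V g] j gj B.basis_closed
          B.lin_ext_basis[OF V.module_axioms gV]
        by (intro exI[of _ "restrict (B.lin_ext V g) (carrier ?A)"]) (auto simp: Pi_iff)
    next
      fix h h'
      assume "h \<in> op_algebra_hom \<Omega> R ?A (linear_extension R \<alpha>) V \<beta> \<inter> extensional (carrier ?A)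
            \<and> (\<forall>x\<in>X. h (basis_elem R (j x)) = f x)"
        and "h' \<in> op_algebra_hom \<Omega> R ?A (linear_extension R \<alpha>) V \<beta> \<inter> extensional (carrier ?A)
            \<and> (\<forall>x\<in>X. h' (basis_elem R (j x)) = f x)"
      then have h: "h \<in> op_algebra_hom \<Omega> R ?A (linear_extension R \<alpha>) V \<beta>"
          "h \<in> extensional (carrier ?A)" "\<forall>x\<in>X. h (basis_elem R (j x)) = f x"
        and h': "h' \<in> op_algebra_hom \<Omega> R ?A (linear_extension R \<alpha>) V \<beta>"
          "h' \<in> extensional (carrier ?A)" "\<forall>x\<in>X. h' (basis_elem R (j x)) = f x"
        by auto
      let ?r = "\<lambda>h. restrict (\<lambda>y. h (basis_elem R y)) (carrier U)"
      have j_closed: "j x \<in> carrier U" if "x \<in> X" for x using j that by auto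
      have unique: "g = g'"
        if "g \<in> op_semigroup_hom \<Omega> U \<alpha> V \<beta> \<inter> extensional (carrier U) \<and> (\<forall>x\<in>X. g (j x) = f x)"
          and "g' \<in> op_semigroup_hom \<Omega> U \<alpha> V \<beta> \<inter> extensional (carrier U) \<and> (\<forall>x\<in>X. g' (j x) = f x)"
        for g g'
        using ex1 that by blast
      have "?r h = ?r h'"
      proof (rule unique)
        show "?r h \<in> op_semigroup_hom \<Omega> U \<alpha> V \<beta> \<inter> extensional (carrier U)
            \<and> (\<forall>x\<in>X. ?r h (j x) = f x)"
          using B.op_algebra_hom_basis[OF U h(1)] h(3) by (simp add: j_closed)
        show "?r h' \<in> op_semigroup_hom \<Omega> U \<alpha> V \<beta> \<inter> extensional (carrier U)
            \<and> (\<forall>x\<in>X. ?r h' (j x) = f x)"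
          using B.op_algebra_hom_basis[OF U h'(1)] h'(3) by (simp add: j_closed)
      qed
      then have basis: "h (basis_elem R y) = h' (basis_elem R y)" if "y \<in> carrier U" for y
        using that by (metis restrict_apply')
      show "h = h'"
      proof (rule extensionalityI)
        show "h \<in> extensional (carrier ?A)" "h' \<in> extensional (carrier ?A)" by fact+
        have lin: "h \<in> linear_maps R ?A V" "h' \<in> linear_maps R ?A V"
          using h(1) h'(1) unfolding op_algebra_hom_def by blast+
        show "h a = h' a" if "a \<in> carrier ?A" for a
          by (rule B.linear_maps_eq_on_basis[OF V.module_axioms lin basis that])
      qed
    qed
  qed
qed

theorem theorem4p2:
  fixes X :: "'x set" and \<Omega> :: "'o set" and R :: "('k, 'l) ring_scheme"
  assumes "X \<noteq> {}" and "\<Omega> \<noteq> {}" and "cring R"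
  shows "free_operated_semigroup TYPE('v) X \<Omega> (forest_semigroup X \<Omega>) graft bullet \<and>
    free_operated_algebra TYPE('w) X \<Omega> R (semigroup_algebra R (forest_semigroup X \<Omega>))
      (linear_extension R graft) (\<lambda>x. basis_elem R (bullet x))"
  using free_operated_semigroup_forests
    free_operated_algebra_semigroup_algebra[OF free_operated_semigroup_forests assms(3)]
  by blast

end
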